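(* Let $\lambda>0$, let $g=\begin{pmatrix}A&B\\C&D\end{pmatrix}\in Sp(n,\mathbb R)$ with $\det B\ne0$, and let $A'_g$ be a unitary operator on $L^2(\mathbb R^n)$ such that $\rho'(g\cdot h)A'_g=A'_g\rho'(h)$ for every $h\in H_n$, given by an integral kernel $a_g(x,y)$, that is, $(A'_g\phi)(x)=\int_{\mathbb R^n}a_g(x,y)\phi(y)\,dy$ for every $\phi\in\mathcal S(\mathbb R^n)$. Then $$a_g(x,y)=c'_g\,\exp\left(-i\lambda\left(\tfrac12x^tDB^{-1}x-(B^{-1}x)^ty+\tfrac12y^tB^{-1}Ay\right)\right),$$ where $c'_g\in\mathbb C$ is a constant.
   Context: Let $n\ge1$; vectors in $\mathbb R^n$ are columns and $x^ty=\sum_jx_jy_j$. $\mathcal S(\mathbb R^n)$ is the Schwartz space. $Sp(n,\mathbb R)$ is the group of real $2n\times2n$ matrices $M$ with $M^tJM=J$, $J=\begin{pmatrix}0&I_n\\-I_n&0\end{pmatrix}$, written in $n\times n$ blocks. The Heisenberg group $H_n$ is the set of $(a,b,c)$, $a,b\in\mathbb R^n$, $c\in\mathbb R$, where $(a,b,c)$ stands for $((z,\bar z),c)$ with $z=a+ib$, with product $((z,\bar z),c)\cdot((z',\bar z'),c')=((z+z',\bar z+\bar z'),c+c'+\frac i4(z^t\bar z'-z'^t\bar z))$. $Sp(n,\mathbb R)$ acts on $H_n$ by $\begin{pmatrix}A&B\\C&D\end{pmatrix}\cdot(a,b,c)=(Aa+Bb,Ca+Db,c)$. The Schrödinger representation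 $\rho'=\rho'_\lambda$ of $H_n$ on $L^2(\mathbb R^n)$ is the unitary irreducible representation $(\rho'(a,b,c)\phi)(x)=\exp(i\lambda(c-b^tx+\frac12a^tb))\phi(x-a)$. For each $g$ there is a unitary operator $A'_g$, unique up to a unit complex number, satisfying the intertwining relation (Stone–von Neumann). The kernel $a_g$ is a locally integrable function on $\mathbb R^{2n}$, regarded as a distribution kernel, so the equality in the claim holds almost everywhere. *)

theory Defs
  imports "HOL-Analysis.Analysis"
begin

section \<open>The symplectic group in block form\<close>

text \<open>The index type \<open>'n + 'n\<close> splits \<open>2n \<times> 2n\<close> matrices into \<open>n \<times> n\<close> blocks, with
  \<open>n = CARD('n)\<close>.\<close>

definition block_mat ::
    "real^'n^'n \<Rightarrow> real^'n^'n \<Rightarrow> real^'n^'n \<Rightarrow> real^'n^'n \<Rightarrow> real^('n + 'n)^('n + 'n)" where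
  "block_mat A B C D = (\<chi> i j. case i of
      Inl k \<Rightarrow> (case j of Inl l \<Rightarrow> A $ k $ l | Inr l \<Rightarrow> B $ k $ l)
    | Inr k \<Rightarrow> (case j of Inl l \<Rightarrow> C $ k $ l | Inr l \<Rightarrow> D $ k $ l))"

definition upper_left :: "real^('n + 'n)^('n + 'n) \<Rightarrow> real^'n^'n" where
  "upper_left M = (\<chi> k l. M $ Inl k $ Inl l)"

definition upper_right :: "real^('n + 'n)^('n + 'n) \<Rightarrow> real^'n^'n" where
  "upper_right M = (\<chi> k l. M $ Inl k $ Inr l)"

definition lower_left :: "real^('n + 'n)^('n + 'n) \<Rightarrow> real^'n^'n" where
  "lower_left M = (\<chi> k l. M $ Inr k $ Inl l)"

definition lower_right :: "real^('n + 'n)^('n + 'n) \<Rightarrow> real^'n^'n" where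
  "lower_right M = (\<chi> k l. M $ Inr k $ Inr l)"

definition J_mat :: "real^('n::finite + 'n)^('n + 'n)" where
  "J_mat = block_mat 0 (mat 1) (- mat 1) 0"

definition Sp :: "(real^('n::finite + 'n)^('n + 'n)) set" where
  "Sp = {M. transpose M ** J_mat ** M = J_mat}"


section \<open>The Heisenberg group and the Schroedinger representation\<close>

text \<open>The triple \<open>(a, b, c)\<close> stands for \<open>((z, cnj z), c)\<close> with \<open>z = a + ib\<close>.\<close>

type_synonym 'n heisenberg = "(real^'n) \<times> (real^'n) \<times> real"

definition heis_z :: "'n::finite heisenberg \<Rightarrow> complex^'n" where
  "heis_z h = (case h of (a, b, c) \<Rightarrow> \<chi> j. Complex (a $ j) (b $ j))"

text \<open>In \<open>heis_mult\<close> the complex number under \<open>Re\<close> is real. The product is not needed to state an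
  intertwining relation; it fixes the group that \<open>schrodinger\<close> represents.\<close>

definition heis_mult :: "'n::finite heisenberg \<Rightarrow> 'n heisenberg \<Rightarrow> 'n heisenberg" where
  "heis_mult h h' = (case (h, h') of ((a, b, c), (a', b', c')) \<Rightarrow>
     (a + a', b + b',
      c + c' + Re (\<i> / 4 * ((\<Sum>j\<in>UNIV. heis_z h $ j * cnj (heis_z h' $ j))
                          - (\<Sum>j\<in>UNIV. heis_z h' $ j * cnj (heis_z h $ j))))))"

definition heis_act :: "real^('n::finite + 'n)^('n + 'n) \<Rightarrow> 'n heisenberg \<Rightarrow> 'n heisenberg" where
  "heis_act g h = (case h of (a, b, c) \<Rightarrow>
     (upper_left g *v a + upper_right g *v b, lower_left g *v a + lower_right g *v b, c))"

definition schrodinger ::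
    "real \<Rightarrow> 'n::finite heisenberg \<Rightarrow> (real^'n \<Rightarrow> complex) \<Rightarrow> real^'n \<Rightarrow> complex" where
  "schrodinger lam h \<phi> x = (case h of (a, b, c) \<Rightarrow>
     exp (\<i> * complex_of_real (lam * (c - b \<bullet> x + 1/2 * (a \<bullet> b)))) * \<phi> (x - a))"

lemma heis_mult_real:
  "heis_mult (a, b, c) (a', b', c') =
     (a + a', b + b', c + c' + 1/2 * (a \<bullet> b') - 1/2 * (b \<bullet> a'))"
proof -
  let ?z = "heis_z (a, b, c)" and ?z' = "heis_z (a', b', c')"
  have "Re (\<i> / 4 * ((\<Sum>j\<in>UNIV. ?z $ j * cnj (?z' $ j)) - (\<Sum>j\<in>UNIV. ?z' $ j * cnj (?z $ j))))
      = (\<Sum>j\<in>UNIV. Re (\<i> / 4 * (?z $ j * cnj (?z' $ j) - ?z' $ j * cnj (?z $ j))))"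
    by (simp only: sum_subtractf[symmetric] sum_distrib_left Re_sum)
  also have "\<dots> = (\<Sum>j\<in>UNIV. 1/2 * (a $ j * b' $ j) - 1/2 * (b $ j * a' $ j))"
    by (rule sum.cong) (simp_all add: heis_z_def field_simps)
  also have "\<dots> = 1/2 * (a \<bullet> b') - 1/2 * (b \<bullet> a')"
    by (simp only: sum_subtractf sum_distrib_left[symmetric] inner_vec_def inner_real_def)
  finally show ?thesis
    by (simp only: heis_mult_def split_conv Pair_inject refl simp_thms add_diff_eq)
qed

lemma schrodinger_mult:
  "schrodinger lam (heis_mult h h') \<phi> = schrodinger lam h (schrodinger lam h' \<phi>)"
proof -
  obtain a b c a' b' c' where h: "h = (a, b, c)" "h' = (a', b', c')"
    by (metis prod_cases3)
  have phase: "lam * (c + c' + 1/2 * (a \<bullet> b') - 1/2 * (b \<bullet> a')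
        - (b + b') \<bullet> x + 1/2 * ((a + a') \<bullet> (b + b')))
      = lam * (c - b \<bullet> x + 1/2 * (a \<bullet> b)) + lam * (c' - b' \<bullet> (x - a) + 1/2 * (a' \<bullet> b'))" for x
    unfolding distrib_left[symmetric]
    by (simp add: inner_add_left inner_add_right inner_diff_right inner_commute[of b a']
        inner_commute[of b' a] add_divide_distrib)
  have factor: "exp (\<i> * complex_of_real (r + s)) =
      exp (\<i> * complex_of_real r) * exp (\<i> * complex_of_real s)" for r s
    by (simp add: exp_add distrib_left)
  show ?thesis
    unfolding h heis_mult_real schrodinger_def split_conv phase factor
    by (simp add: mult.assoc diff_diff_eq)
qed


section \<open>The Hilbert space of square integrable functions\<close>

text \<open>Elements of \<open>L\<^sup>2\<close> are represented by functions, and equality in \<open>L\<^sup>2\<close> is equality almost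
  everywhere. An operator on \<open>L\<^sup>2\<close> is a map on functions that respects this equality; its values
  outside \<open>L2_space\<close> are irrelevant.\<close>

definition L2_space :: "('a::euclidean_space \<Rightarrow> complex) set" where
  "L2_space = {f. f \<in> borel_measurable lebesgue \<and> integrable lebesgue (\<lambda>x. (cmod (f x))\<^sup>2)}"

definition L2_inner :: "('a::euclidean_space \<Rightarrow> complex) \<Rightarrow> ('a \<Rightarrow> complex) \<Rightarrow> complex" where
  "L2_inner f g = (LINT x|lebesgue. f x * cnj (g x))"

definition L2_eq :: "('a::euclidean_space \<Rightarrow> complex) \<Rightarrow> ('a \<Rightarrow> complex) \<Rightarrow> bool" where
  "L2_eq f g \<longleftrightarrow> (AE x in lebesgue. f x = g x)"

definition L2_unitary :: "(('a::euclidean_space \<Rightarrow> complex) \<Rightarrow> ('a \<Rightarrow> complex)) \<Rightarrow> bool" where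
  "L2_unitary U \<longleftrightarrow>
     (\<forall>f\<in>L2_space. U f \<in> L2_space) \<and>
     (\<forall>f\<in>L2_space. \<forall>g\<in>L2_space. L2_eq f g \<longrightarrow> L2_eq (U f) (U g)) \<and>
     (\<forall>f\<in>L2_space. \<forall>g\<in>L2_space. \<forall>s t.
        L2_eq (U (\<lambda>x. s * f x + t * g x)) (\<lambda>x. s * U f x + t * U g x)) \<and>
     (\<forall>f\<in>L2_space. \<forall>g\<in>L2_space. L2_inner (U f) (U g) = L2_inner f g) \<and>
     (\<forall>g\<in>L2_space. \<exists>f\<in>L2_space. L2_eq (U f) g)"


section \<open>Schwartz functions and locally integrable functions\<close>

definition partial_deriv :: "'n::finite \<Rightarrow> (real^'n \<Rightarrow> complex) \<Rightarrow> real^'n \<Rightarrow> complex" where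
  "partial_deriv j f x = frechet_derivative f (at x) (axis j 1)"

text \<open>\<open>frechet_derivative\<close> is meaningful only where the function is differentiable, which
  \<open>schwartz_space\<close> requires of all iterated partial derivatives; this is smoothness.\<close>

definition iter_partial :: "'n::finite list \<Rightarrow> (real^'n \<Rightarrow> complex) \<Rightarrow> real^'n \<Rightarrow> complex" where
  "iter_partial js f = foldr partial_deriv js f"

definition schwartz_space :: "(real^'n::finite \<Rightarrow> complex) set" where
  "schwartz_space = {f.
     (\<forall>js x. iter_partial js f differentiable (at x)) \<and>
     (\<forall>(\<alpha>::'n \<Rightarrow> nat) js. bounded (range (\<lambda>x. (\<Prod>j\<in>UNIV. (x $ j) ^ \<alpha> j) *\<^sub>R iter_partial js f x)))}"

definition locally_integrable :: "('a::euclidean_space \<Rightarrow> complex) \<Rightarrow> bool" where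
  "locally_integrable f \<longleftrightarrow> (\<forall>K. compact K \<longrightarrow> set_integrable lebesgue K f)"

end

theory Submission
  imports Defs "HOL-Computational_Algebra.Polynomial"
begin

text \<open>Let \<open>k\<close> be the exponential of the claim and write \<open>a = k \<cdot> b\<close>. Tested against functions \<open>\<phi>\<close>, the
  intertwining relation for \<open>h = (p, q, 0)\<close> says that \<open>a\<close> satisfies a covariance identity relating its
  values at \<open>(x - p', y)\<close> and \<open>(x, y + p)\<close>, where \<open>p' = A p + B q\<close>. The symplectic relations show that
  \<open>k\<close> satisfies the same identity, so \<open>b (x - p', y) = b (x, y + p)\<close> almost everywhere. As \<open>B\<close> is
  invertible, \<open>p\<close> and \<open>p'\<close> are arbitrary; hence \<open>b\<close> is invariant under each translation almost
  everywhere, and by Fubini it is almost everywhere constant. Since \<open>a\<close> is only locally integrable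
  (a divergent integral has value \<open>0\<close> by convention), all tests are made with compactly supported
  \<open>\<phi>\<close>, and these approximate indicator functions of boxes.\<close>

section \<open>Almost everywhere vanishing and constancy\<close>

text \<open>Boxes are stable under intersection and generate the Borel sets, so a Dynkin argument
  carries vanishing integrals from boxes to all Borel sets. As \<open>f\<close> is integrable on
  boxes only, it is first cut off to the exhausting boxes \<open>B n\<close>.\<close>

lemma AE_zero_if_box_integrals_zero:
  fixes f :: "'a::euclidean_space \<Rightarrow> 'b::{banach, second_countable_topology}"
  assumes int: "\<And>l u. set_integrable lborel (box l u) f"
    and zero: "\<And>l u. (LINT x:box l u|lborel. f x) = 0"
  shows "AE x in lborel. f x = 0"
proof -
  define B :: "nat \<Rightarrow> 'a set" where "B n = box (- (real n *\<^sub>R One)) (real n *\<^sub>R One)" for n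
  have "AE x in lborel. indicator (B n) x *\<^sub>R f x = 0" for n
  proof (rule sigma_finite_measure.density_zero[OF sigma_finite_lborel])
    let ?f = "\<lambda>x. indicator (B n) x *\<^sub>R f x"
    show intf: "integrable lborel ?f"
      using int unfolding B_def set_integrable_def by simp
    have intA: "set_integrable lborel A ?f" if "A \<in> sets lborel" for A
      unfolding set_integrable_def by (rule integrable_mult_indicator[OF that intf])
    let ?E = "range (\<lambda>(a, b). box a b :: 'a set)"
    have borel_gen: "sets lborel = sigma_sets UNIV ?E"
      by (simp add: borel_eq_box)
    fix A :: "'a set" assume "A \<in> sets lborel"
    then have A: "A \<in> sigma_sets UNIV ?E"
      by (simp only: borel_gen)
    have stable: "Int_stable ?E"
      by (auto simp: Int_stable_def box_Int_box)
    have closed: "?E \<subseteq> Pow UNIV" by simp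
    show "set_lebesgue_integral lborel A ?f = 0"
      using stable closed A
    proof (induction rule: sigma_sets_induct_disjoint)
      case (basic A)
      then obtain l u where "A = box l u" by auto
      then obtain l' u' where "A \<inter> B n = box l' u'"
        by (auto simp: B_def box_Int_box)
      then have "set_lebesgue_integral lborel A ?f = (LINT x:box l' u'|lborel. f x)"
        unfolding set_lebesgue_integral_def
        by (metis (no_types, lifting) indicator_inter_arith scaleR_scaleR)
      then show ?case using zero by simp
    next
      case (compl A)
      then have m: "A \<in> sets lborel" by (simp only: borel_gen)
      \<comment> \<open>The integral over the complement is the total integral minus that over
        \<open>A\<close>, and the total is the integral of \<open>f\<close> over the box
        \<open>B n\<close>, which is zero.\<close>
      have "(LINT x:A \<union> (UNIV - A)|lborel. ?f x)
          = (LINT x:A|lborel. ?f x) + (LINT x:UNIV - A|lborel. ?f x)"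
        using m by (intro set_integral_Un intA) auto
      moreover have "(LINT x:A \<union> (UNIV - A)|lborel. ?f x) = (LINT x:B n|lborel. f x)"
        unfolding set_lebesgue_integral_def by simp
      ultimately show ?case
        using compl zero unfolding B_def by simp
    next
      case (union A)
      then have "range A \<subseteq> sets lborel" by (simp only: borel_gen)
      with union have "(LINT x:(\<Union>i. A i)|lborel. ?f x) = (\<Sum>i. LINT x:A i|lborel. ?f x)"
        by (intro lebesgue_integral_countable_add intA)
          (auto simp: disjoint_family_on_def)
      then show ?case using union by simp
    qed (simp_all add: set_lebesgue_integral_def)
  qed
  then have "AE x in lborel. \<forall>n. indicator (B n) x *\<^sub>R f x = 0"
    by (simp add: AE_all_countable del: scaleR_eq_0_iff)
  then show ?thesis
  proof (rule eventually_mono)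
    fix x assume *: "\<forall>n. indicator (B n) x *\<^sub>R f x = 0"
    obtain n where "x \<in> B n"
      using UN_box_eq_UNIV unfolding B_def by blast
    then show "f x = 0" using *[rule_format, of n] by simp
  qed
qed

section \<open>Translation invariance of Lebesgue measure and translation invariant
  functions\<close>

lemma AE_lborel_translate:
  fixes t :: "'a::euclidean_space"
  assumes "AE x in lborel. P x"
  shows "AE x in lborel. P (t + x)"
  using AE_distrD[of "(+) t" lborel borel P, unfolded lborel_distr_plus] assms by simp

lemma AE_lborel_translate':
  fixes t :: "'a::euclidean_space"
  assumes "AE x in lborel. P x"
  shows "AE x in lborel. P (x + t)" "AE x in lborel. P (x - t)"
  using AE_lborel_translate[OF assms, of t] AE_lborel_translate[OF assms, of "- t"]
  by (simp_all add: add.commute)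

lemma integral_lborel_translate:
  fixes f :: "'a::euclidean_space \<Rightarrow> 'b::{banach, second_countable_topology}"
  assumes "f \<in> borel_measurable borel"
  shows "(LINT x|lborel. f (x + t)) = (LINT x|lborel. f x)"
  using integral_distr[of "(+) t" lborel borel f] assms
  by (simp add: lborel_distr_plus add.commute[of _ t])

lemma integrable_lborel_translate:
  fixes f :: "'a::euclidean_space \<Rightarrow> 'b::{banach, second_countable_topology}"
  assumes "integrable lborel f"
  shows "integrable lborel (\<lambda>x. f (x + t))"
  using integrable_distr[of "(+) t" lborel borel f] assms
  by (simp add: lborel_distr_plus add.commute[of _ t])

text \<open>The exceptional null set in \<open>inv\<close> depends on \<open>w\<close>. Fubini
  exchanges the two quantifiers and yields one base point \<open>z\<close> with
  \<open>b (z + w) = b z\<close> for almost every \<open>w\<close>; the constant is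
  \<open>b z\<close>.\<close>

lemma AE_const_if_translation_invariant:
  fixes b :: "'a::euclidean_space \<Rightarrow> 'b::{second_countable_topology, t2_space}"
  assumes [measurable]: "b \<in> borel_measurable borel"
    and inv: "\<And>w. AE z in lborel. b (z + w) = b z"
  shows "\<exists>c. AE z in lborel. b z = c"
proof -
  have [measurable]: "(\<lambda>x. b (snd x + fst x)) \<in> borel_measurable (lborel \<Otimes>\<^sub>M lborel)"
    "(\<lambda>x. b (snd x)) \<in> borel_measurable (lborel \<Otimes>\<^sub>M lborel)"
    by measurable
  have "{x \<in> space (lborel \<Otimes>\<^sub>M lborel). b (snd x + fst x) = b (snd x)} \<in> sets (lborel \<Otimes>\<^sub>M lborel)"
    by measurable
  from lborel_pair.AE_commute[OF this] inv have "AE z in lborel. AE w in lborel. b (z + w) = b z"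
    by simp
  \<comment> \<open>Lebesgue measure is not zero, so a property of almost every \<open>z\<close> has
    a witness.\<close>
  moreover have "\<not> (AE z::'a in lborel. False)"
    by (simp add: trivial_limit_def[symmetric] ae_filter_eq_bot_iff)
  ultimately obtain z where "AE w in lborel. b (z + w) = b z"
    by (metis (mono_tags, lifting) eventually_mono)
  then have "AE w in lborel. b (z + (- z + w)) = b z"
    by (rule AE_lborel_translate)
  then show ?thesis by (auto intro!: exI[of _ "b z"])
qed

section \<open>Smooth bump functions\<close>

text \<open>The functions \<open>P(1/t) exp(-1/t)\<close> for \<open>t > 0\<close>, extended by \<open>0\<close>, form a class closed under
  differentiation; this is why the standard bump function is smooth.\<close>

definition flat :: "real poly \<Rightarrow> real \<Rightarrow> real" where
  "flat P t = (if t > 0 then poly P (1 / t) * exp (- 1 / t) else 0)"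

lemma poly_times_exp_tendsto_0:
  fixes P :: "real poly"
  shows "((\<lambda>s. poly P s * exp (- s)) \<longlongrightarrow> 0) at_top"
proof -
  have "((\<lambda>s. \<Sum>i\<le>degree P. coeff P i * (s ^ i / exp s)) \<longlongrightarrow> (\<Sum>i\<le>degree P. coeff P i * 0)) at_top"
    by (intro tendsto_sum tendsto_mult tendsto_const tendsto_power_div_exp_0)
  then show ?thesis
    by (simp add: poly_altdef exp_minus sum_distrib_right divide_inverse mult.assoc)
qed

text \<open>For \<open>t > 0\<close> the chain rule brings out \<open>1 / t^2\<close>, encoded by
  the polynomial \<open>[:0, 0, 1:]\<close>, with a minus sign where \<open>poly P (1 / t)\<close>
  is differentiated. At \<open>0\<close> the exponential beats every power of
  \<open>1 / t\<close>.\<close>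

lemma flat_has_derivative:
  "(flat P has_real_derivative flat ([:0, 0, 1:] * (P - pderiv P)) t) (at t)"
proof -
  consider "t > 0" | "t < 0" | "t = 0" by linarith
  then show ?thesis
  proof cases
    case 1
    have "((\<lambda>t. poly P (1 / t) * exp (- 1 / t)) has_real_derivative
        flat ([:0, 0, 1:] * (P - pderiv P)) t) (at t)"
      using 1
      by (auto intro!: derivative_eq_intros simp: flat_def field_simps power2_eq_square)
    then show ?thesis
      by (rule DERIV_cong_ev[THEN iffD1, rotated 3])
        (use 1 in \<open>auto simp: flat_def intro!: eventually_nhds_in_open[of "{0<..}", THEN eventually_mono]\<close>)
  next
    case 2
    have "((\<lambda>_. 0) has_real_derivative flat ([:0, 0, 1:] * (P - pderiv P)) t) (at t)"
      using 2 by (auto simp: flat_def)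
    then show ?thesis
      by (rule DERIV_cong_ev[THEN iffD1, rotated 3])
        (use 2 in \<open>auto simp: flat_def intro!: eventually_nhds_in_open[of "{..<0}", THEN eventually_mono]\<close>)
  next
    case 3
    \<comment> \<open>Dividing by \<open>h\<close> multiplies the polynomial in \<open>1 / h\<close>
      by its variable, so the quotient has the same shape as \<open>flat\<close> itself.\<close>
    have right: "((\<lambda>h. flat P h / h) \<longlongrightarrow> 0) (at_right 0)"
    proof (rule Lim_transform_eventually)
      show "((\<lambda>h. poly ([:0, 1:] * P) (inverse h) * exp (- inverse h)) \<longlongrightarrow> 0) (at_right 0)"
        by (rule filterlim_compose[OF poly_times_exp_tendsto_0 filterlim_inverse_at_top_right])
      show "\<forall>\<^sub>F h in at_right 0. poly ([:0, 1:] * P) (inverse h) * exp (- inverse h) = flat P h / h"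
        using eventually_at_right_less[of "0::real"]
        by eventually_elim (simp add: flat_def field_simps)
    qed
    have left: "((\<lambda>h. flat P h / h) \<longlongrightarrow> 0) (at_left 0)"
    proof (rule Lim_transform_eventually)
      show "((\<lambda>h. 0) \<longlongrightarrow> (0::real)) (at_left 0)" by simp
      show "\<forall>\<^sub>F h in at_left 0. 0 = flat P h / h"
        by (auto simp: eventually_at_filter flat_def)
    qed
    from left right show ?thesis
      unfolding has_field_derivative_iff 3
      by (simp add: filterlim_at_split flat_def)
  qed
qed

text \<open>Being closed under partial derivatives, this class makes smoothness of all products of shifted
  bumps and plane waves a single induction.\<close>

inductive_set test_gen :: "(real^'n::finite \<Rightarrow> complex) set" where
  flat: "(\<lambda>x. complex_of_real (flat P (w \<bullet> x + c))) \<in> test_gen"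
| wave: "(\<lambda>x. exp (\<i> * complex_of_real (w \<bullet> x))) \<in> test_gen"
| const: "(\<lambda>x. z) \<in> test_gen"
| add: "f \<in> test_gen \<Longrightarrow> g \<in> test_gen \<Longrightarrow> (\<lambda>x. f x + g x) \<in> test_gen"
| mult: "f \<in> test_gen \<Longrightarrow> g \<in> test_gen \<Longrightarrow> (\<lambda>x. f x * g x) \<in> test_gen"

lemma test_gen_prod:
  assumes "finite I" "\<And>i. i \<in> I \<Longrightarrow> f i \<in> test_gen"
  shows "(\<lambda>x. \<Prod>i\<in>I. f i x) \<in> test_gen"
  using assms by (induction I rule: finite_induct) (auto intro: test_gen.intros)

text \<open>Closure is stated for each fixed direction \<open>v\<close> because
  \<open>v = axis j 1\<close> gives the partial derivatives. Generators differentiate to scalar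
  multiples of generators of the same kind; the sum and product rules do the rest.\<close>

lemma test_gen_has_derivative:
  assumes "f \<in> test_gen"
  shows "\<exists>f'. (\<forall>x. (f has_derivative f' x) (at x)) \<and> (\<forall>v. (\<lambda>x. f' x v) \<in> test_gen)"
  using assms
proof induction
  case (flat P w c)
  let ?f' = "\<lambda>x v. complex_of_real (flat ([:0, 0, 1:] * (P - pderiv P)) (w \<bullet> x + c))
    * complex_of_real (w \<bullet> v)"
  have "((\<lambda>x. complex_of_real (flat P (w \<bullet> x + c))) has_derivative ?f' x) (at x)" for x
  proof -
    have "((\<lambda>x. flat P (w \<bullet> x + c)) has_derivative
        (\<lambda>v. (w \<bullet> v) * flat ([:0, 0, 1:] * (P - pderiv P)) (w \<bullet> x + c))) (at x)"
      by (rule DERIV_compose_FDERIV[OF flat_has_derivative])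
        (auto intro!: derivative_eq_intros)
    from has_derivative_of_real[OF this, where 'a = complex] show ?thesis
      by (simp add: mult.commute)
  qed
  then show ?case by (intro exI[of _ ?f']) (auto intro: test_gen.intros)
next
  case (wave w)
  let ?f' = "\<lambda>x v. exp (\<i> * complex_of_real (w \<bullet> x)) * (\<i> * complex_of_real (w \<bullet> v))"
  have "((\<lambda>x. exp (\<i> * complex_of_real (w \<bullet> x))) has_derivative ?f' x) (at x)" for x
  proof -
    have "((\<lambda>x. \<i> * complex_of_real (w \<bullet> x)) has_derivative (\<lambda>v. \<i> * complex_of_real (w \<bullet> v))) (at x)"
      by (intro has_derivative_mult_right has_derivative_of_real has_derivative_inner_right has_derivative_ident)
    from has_derivative_compose[OF this DERIV_exp[unfolded has_field_derivative_def]] show ?thesis .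
  qed
  then show ?case by (intro exI[of _ ?f']) (auto intro: test_gen.intros)
next
  case (const z)
  then show ?case
    by (intro exI[of _ "\<lambda>x v. 0"]) (auto intro: test_gen.intros)
next
  case (add f g)
  then obtain f' g' where "\<forall>x. (f has_derivative f' x) (at x)" "\<forall>v. (\<lambda>x. f' x v) \<in> test_gen"
    "\<forall>x. (g has_derivative g' x) (at x)" "\<forall>v. (\<lambda>x. g' x v) \<in> test_gen" by blast
  then show ?case
    by (intro exI[of _ "\<lambda>x v. f' x v + g' x v"]) (auto intro: test_gen.intros has_derivative_add)
next
  case (mult f g)
  then obtain f' g' where "\<forall>x. (f has_derivative f' x) (at x)" "\<forall>v. (\<lambda>x. f' x v) \<in> test_gen"
    "\<forall>x. (g has_derivative g' x) (at x)" "\<forall>v. (\<lambda>x. g' x v) \<in> test_gen" by blast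
  with mult.hyps show ?case
    by (intro exI[of _ "\<lambda>x v. f x * g' x v + f' x v * g x"])
      (auto intro!: test_gen.intros has_derivative_mult)
qed

section \<open>Regularity and decay of compactly supported test functions\<close>

lemma test_gen_differentiable:
  assumes "f \<in> test_gen" shows "f differentiable (at x)"
  using test_gen_has_derivative[OF assms] unfolding differentiable_def by blast

lemma test_gen_continuous_on:
  assumes "f \<in> test_gen" shows "continuous_on S f"
  using test_gen_differentiable[OF assms]
  by (auto intro: continuous_at_imp_continuous_on differentiable_imp_continuous_within)

lemma test_gen_borel_measurable:
  assumes "f \<in> test_gen" shows "f \<in> borel_measurable borel"
  by (rule borel_measurable_continuous_onI[OF test_gen_continuous_on[OF assms]])

lemma test_gen_partial_deriv:
  assumes "f \<in> test_gen" shows "partial_deriv j f \<in> test_gen"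
proof -
  obtain f' where f': "\<And>x. (f has_derivative f' x) (at x)" "\<And>v. (\<lambda>x. f' x v) \<in> test_gen"
    using test_gen_has_derivative[OF assms] by blast
  have "partial_deriv j f = (\<lambda>x. f' x (axis j 1))"
    unfolding partial_deriv_def frechet_derivative_at[OF f'(1), symmetric] ..
  with f'(2) show ?thesis by simp
qed

text \<open>The complement of \<open>K\<close> is open, so \<open>f\<close> vanishes in a whole
  neighbourhood of \<open>x\<close>.\<close>

lemma partial_deriv_eq_0_outside:
  assumes "closed K" "\<And>x. x \<notin> K \<Longrightarrow> f x = 0" "x \<notin> K"
  shows "partial_deriv j f x = 0"
proof -
  have "(f has_derivative (\<lambda>_. 0)) (at x)"
    by (rule has_derivative_transform_within_open[of "\<lambda>_. 0" _ _ _ "- K"]) (use assms in auto)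
  then show ?thesis
    unfolding partial_deriv_def by (simp add: frechet_derivative_at[symmetric])
qed

lemma iter_partial_test_gen:
  assumes "f \<in> test_gen" "closed K" "\<And>x. x \<notin> K \<Longrightarrow> f x = 0"
  shows "iter_partial js f \<in> test_gen \<and> (\<forall>x. x \<notin> K \<longrightarrow> iter_partial js f x = 0)"
  using assms
  by (induction js)
    (auto simp: iter_partial_def intro: test_gen_partial_deriv partial_deriv_eq_0_outside)

lemma bounded_range_if_compact_support:
  fixes f :: "'a::topological_space \<Rightarrow> 'b::real_normed_vector"
  assumes "compact K" "continuous_on K f" "\<And>x. x \<notin> K \<Longrightarrow> f x = 0"
  shows "bounded (range f)"
proof -
  have "range f \<subseteq> insert 0 (f ` K)" using assms(3) by auto
  moreover have "bounded (insert 0 (f ` K))"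
    using compact_imp_bounded[OF compact_continuous_image[OF assms(2,1)]] by simp
  ultimately show ?thesis by (rule bounded_subset[rotated])
qed

text \<open>All iterated partial derivatives are continuous and vanish off the same compact set, so
  they stay bounded after multiplication by any monomial.\<close>

lemma test_gen_schwartz:
  assumes "f \<in> test_gen" "compact K" "\<And>x. x \<notin> K \<Longrightarrow> f x = 0"
  shows "f \<in> schwartz_space"
proof -
  note * = iter_partial_test_gen[OF assms(1) compact_imp_closed[OF assms(2)] assms(3)]
  have "bounded (range (\<lambda>x. (\<Prod>j\<in>UNIV. (x $ j) ^ \<alpha> j) *\<^sub>R iter_partial js f x))" for \<alpha> js
    using * by (intro bounded_range_if_compact_support[OF assms(2)] continuous_intros test_gen_continuous_on) auto
  with * show ?thesis
    unfolding schwartz_space_def by (auto intro: test_gen_differentiable)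
qed

lemma test_gen_L2:
  assumes "f \<in> test_gen" "compact K" "\<And>x. x \<notin> K \<Longrightarrow> f x = 0"
  shows "f \<in> L2_space"
proof -
  have [measurable]: "f \<in> borel_measurable borel" by (rule test_gen_borel_measurable[OF assms(1)])
  have "(\<lambda>x. (cmod (f x))\<^sup>2) = (\<lambda>x. indicator K x *\<^sub>R (cmod (f x))\<^sup>2)"
    using assms(3) by (intro ext) (auto simp: indicator_def)
  moreover have "integrable lborel (\<lambda>x. indicator K x *\<^sub>R (cmod (f x))\<^sup>2)"
    using test_gen_continuous_on[OF assms(1)] assms(2)
    by (intro borel_integrable_compact continuous_intros) auto
  ultimately show ?thesis
    unfolding L2_space_def by (auto simp: integrable_completion intro: measurable_completion)
qed

text \<open>On the positive axis \<open>flat 1 t\<close> is \<open>exp (- 1 / t)\<close>. Scaling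
  its argument by \<open>Suc k\<close> drives each factor to 1 inside the box as \<open>k\<close>
  grows, while every bump vanishes off the box.\<close>

definition bump :: "real^'n::finite \<Rightarrow> real^'n \<Rightarrow> nat \<Rightarrow> real^'n \<Rightarrow> complex" where
  "bump l u k x = (\<Prod>j\<in>UNIV. complex_of_real (flat 1 (real (Suc k) * (x $ j - l $ j)))
      * complex_of_real (flat 1 (real (Suc k) * (u $ j - x $ j))))"

lemma bump_test_gen:
  fixes l u :: "real^'n::finite"
  shows "bump l u k \<in> test_gen"
proof -
  let ?m = "real (Suc k)"
  \<comment> \<open>Scaled coordinate differences are written as \<open>w \<bullet> x + c\<close> to
    match the generators.\<close>
  have "(\<lambda>x. \<Prod>j\<in>UNIV. complex_of_real (flat 1 ((?m *\<^sub>R axis j 1) \<bullet> x + (- ?m * l $ j)))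
      * complex_of_real (flat 1 ((- ?m *\<^sub>R axis j 1) \<bullet> x + ?m * u $ j))) \<in> test_gen"
    by (intro test_gen_prod test_gen.intros finite)
  then show ?thesis
    unfolding bump_def[abs_def]
    by (simp add: inner_axis' right_diff_distrib del: of_nat_Suc)
qed

lemma bump_eq_0:
  assumes "x \<notin> box l u"
  shows "bump l u k x = 0"
proof -
  obtain j where "\<not> (l $ j < x $ j \<and> x $ j < u $ j)"
    using assms by (auto simp: mem_box_cart)
  then show ?thesis
    unfolding bump_def
    by (intro prod_zero bexI[of _ j]) (auto simp: flat_def zero_less_mult_iff)
qed

lemma norm_bump_le_1: "norm (bump l u k x) \<le> 1"
proof -
  have "\<bar>flat 1 t\<bar> \<le> 1" for t by (simp add: flat_def)
  then show ?thesis
    unfolding bump_def prod_norm[symmetric] norm_mult norm_of_real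
    by (intro prod_le_1 conjI mult_le_one mult_nonneg_nonneg) auto
qed

lemma bump_translate: "bump l u k (x - p) = bump (l + p) (u + p) k x"
  by (simp add: bump_def algebra_simps)

lemma bump_tendsto:
  fixes l u x :: "real^'n::finite"
  shows "(\<lambda>k. bump l u k x) \<longlonglongrightarrow> indicator (box l u) x"
proof (cases "x \<in> box l u")
  case True
  have flat: "(\<lambda>k. flat 1 (real (Suc k) * t)) \<longlonglongrightarrow> 1" if "t > 0" for t
  proof -
    have "(\<lambda>k. exp (- (1 / t) * (1 / real (Suc k)))) \<longlonglongrightarrow> exp (- (1 / t) * 0)"
      by (intro tendsto_intros LIMSEQ_Suc[OF lim_1_over_n])
    then show ?thesis using that by (simp add: flat_def mult.commute del: of_nat_Suc)
  qed
  have "(\<lambda>k. bump l u k x) \<longlonglongrightarrow> (\<Prod>j\<in>(UNIV :: 'n set). complex_of_real 1 * complex_of_real 1)"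
    unfolding bump_def
    by (intro tendsto_prod tendsto_mult tendsto_of_real flat) (use True in \<open>auto simp: mem_box_cart\<close>)
  with True show ?thesis by simp
qed (simp add: bump_eq_0)

section \<open>Testing kernels against bump functions\<close>

lemma box_Pair: "box (a, c) (b, d) = box a b \<times> box c d"
  by (auto simp: box_def Basis_prod_def ball_Un)

text \<open>Fubini turns the iterated integral into one over the product. There dominated
  convergence applies, with \<open>F\<close> cut off to the box as majorant, since bumps are bounded
  by 1.\<close>

lemma integral_bump_tendsto:
  fixes F :: "'a::euclidean_space \<times> (real^'n::finite) \<Rightarrow> complex"
  assumes int: "set_integrable lborel (box (a, c) (b, d)) F"
  shows "(\<lambda>k. LINT x|lborel. indicator (box a b) x *\<^sub>R (LINT y|lborel. F (x, y) * bump c d k y))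
    \<longlonglongrightarrow> (LINT z:box (a, c) (b, d)|lborel. F z)"
proof -
  define H where "H z = indicator (box (a, c) (b, d)) z *\<^sub>R F z" for z
  have intH: "integrable lborel H"
    using int unfolding H_def[abs_def] set_integrable_def .
  have [measurable]: "H \<in> borel_measurable borel"
    using borel_measurable_integrable[OF intH] by simp
  have [measurable]: "bump c d k \<in> borel_measurable borel" for k
    by (rule test_gen_borel_measurable[OF bump_test_gen])
  have [measurable]: "(\<lambda>z. bump c d k (snd z)) \<in> borel_measurable (borel :: ('a \<times> (real^'n)) measure)" for k
    by (rule measurable_compose[OF borel_measurable_continuous_onI]) (auto intro: continuous_intros)
  let ?Hk = "\<lambda>k z. H z * bump c d k (snd z)"
  have meas: "?Hk k \<in> borel_measurable lborel" for k by measurable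
  have bound: "norm (?Hk k z) \<le> norm (H z)" for k z
    using norm_bump_le_1[of c d k "snd z"] by (simp add: norm_mult mult_left_le)
  have intHk: "integrable lborel (?Hk k)" for k
    by (rule Bochner_Integration.integrable_bound[OF intH meas]) (simp add: bound)
  have "(\<lambda>k. LINT z|lborel. ?Hk k z) \<longlonglongrightarrow> (LINT z|lborel. H z)"
  proof (rule integral_dominated_convergence)
    have "(\<lambda>k. ?Hk k z) \<longlonglongrightarrow> H z * indicator (box c d) (snd z)" for z
      by (intro tendsto_mult tendsto_const bump_tendsto)
    moreover have "H z * indicator (box c d) (snd z) = H z" for z
      by (cases z) (auto simp: H_def box_Pair indicator_def)
    ultimately show "AE z in lborel. (\<lambda>k. ?Hk k z) \<longlonglongrightarrow> H z" by simp
    show "AE z in lborel. norm (?Hk k z) \<le> norm (H z)" for k by (simp add: bound)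
  qed (use intH meas in auto)
  moreover have "(LINT z|lborel. ?Hk k z)
      = (LINT x|lborel. indicator (box a b) x *\<^sub>R (LINT y|lborel. F (x, y) * bump c d k y))" for k
  proof -
    \<comment> \<open>The bump vanishes off \<open>box c d\<close>, so the cut-off of
      \<open>F\<close> in \<open>y\<close> leaves the integrand unchanged.\<close>
    have eq: "?Hk k (x, y) = indicator (box a b) x *\<^sub>R (F (x, y) * bump c d k y)" for x y
      by (auto simp: H_def box_Pair indicator_def bump_eq_0)
    have "(LINT z|lborel. ?Hk k z) = (LINT x|lborel. LINT y|lborel. ?Hk k (x, y))"
      using lborel_pair.integral_fst'[of "?Hk k"] intHk by (simp add: lborel_prod)
    also have "\<dots> = (LINT x|lborel. indicator (box a b) x *\<^sub>R (LINT y|lborel. F (x, y) * bump c d k y))"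
      unfolding eq by simp
    finally show ?thesis .
  qed
  ultimately show ?thesis
    unfolding H_def set_lebesgue_integral_def by simp
qed

text \<open>The exceptional set of \<open>x\<close> may vary with the bump: for each bump only
  integrals over \<open>x\<close> are compared. The limit in \<open>k\<close> makes the integrals
  over every box agree, so \<open>F - G\<close> vanishes almost everywhere.\<close>

lemma AE_eq_if_bump_integrals_eq:
  fixes F G :: "'a::euclidean_space \<times> (real^'n::finite) \<Rightarrow> complex"
  assumes F: "\<And>l u. set_integrable lborel (box l u) F"
    and G: "\<And>l u. set_integrable lborel (box l u) G"
    and eq: "\<And>l u k. AE x in lborel.
      (LINT y|lborel. F (x, y) * bump l u k y) = (LINT y|lborel. G (x, y) * bump l u k y)"
    and [measurable]: "F \<in> borel_measurable borel" "G \<in> borel_measurable borel"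
  shows "AE z in lborel. F z = G z"
proof -
  have [measurable]: "bump c d k \<in> borel_measurable borel" for c d :: "real^'n" and k
    by (rule test_gen_borel_measurable[OF bump_test_gen])
  have box_eq: "(LINT z:box l u|lborel. F z) = (LINT z:box l u|lborel. G z)" for l u
  proof -
    obtain a c b d where lu: "l = (a, c)" "u = (b, d)" by (metis prod.exhaust)
    have "(LINT x|lborel. indicator (box a b) x *\<^sub>R (LINT y|lborel. F (x, y) * bump c d k y))
        = (LINT x|lborel. indicator (box a b) x *\<^sub>R (LINT y|lborel. G (x, y) * bump c d k y))" for k
      by (rule integral_cong_AE) (use eq[of c d k] in \<open>auto elim: eventually_mono\<close>)
    with integral_bump_tendsto[OF F[of "(a, c)" "(b, d)"]] integral_bump_tendsto[OF G[of "(a, c)" "(b, d)"]]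
    show ?thesis unfolding lu by (simp add: LIMSEQ_unique)
  qed
  have "AE z in lborel. F z - G z = 0"
  proof (rule AE_zero_if_box_integrals_zero)
    show "set_integrable lborel (box l u) (\<lambda>z. F z - G z)" for l u
      by (rule set_integral_diff[OF F G])
    show "(LINT z:box l u|lborel. F z - G z) = 0" for l u
      unfolding set_integral_diff(2)[OF F G] box_eq by simp
  qed
  then show ?thesis by simp
qed

section \<open>Passing from Lebesgue to Borel measurable kernels\<close>

lemma borel_measurable_lebesgue_cong_AE:
  fixes f g :: "'a::euclidean_space \<Rightarrow> 'b::topological_space"
  assumes g: "g \<in> borel_measurable lebesgue" and eq: "AE x in lborel. f x = g x"
  shows "f \<in> borel_measurable lebesgue"
proof (rule measurableI)
  fix S :: "'b set" assume "S \<in> sets borel"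
  with g have A: "g -` S \<inter> space lebesgue \<in> sets lebesgue" by (rule measurable_sets)
  have ae: "AE x in lebesgue. x \<in> g -` S \<inter> space lebesgue \<longleftrightarrow> x \<in> f -` S \<inter> space lebesgue"
    unfolding AE_completion_iff using eq by (rule eventually_mono) simp
  show "f -` S \<inter> space lebesgue \<in> sets lebesgue"
    by (rule completion.in_sets_AE[OF ae A]) simp
qed auto

lemma lebesgue_integral_cong_AE:
  fixes f g :: "'a::euclidean_space \<Rightarrow> 'b::{banach, second_countable_topology}"
  assumes g: "g \<in> borel_measurable borel" and eq: "AE x in lborel. f x = g x"
  shows "(LINT x|lebesgue. f x) = (LINT x|lborel. g x)"
proof -
  have g': "g \<in> borel_measurable lebesgue"
    using g by (intro measurable_completion) simp
  have "(LINT x|lebesgue. f x) = (LINT x|lebesgue. g x)"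
    using borel_measurable_lebesgue_cong_AE[OF g' eq] g' eq
    by (intro integral_cong_AE) (simp_all add: AE_completion_iff)
  with g show ?thesis by (simp add: integral_completion)
qed

text \<open>By Fubini, almost every slice of a null set in the product is a null set, so changing
  the kernel there alters the integral for almost no \<open>x\<close>.\<close>

lemma AE_kernel_integral_cong:
  fixes f f' :: "'a::euclidean_space \<times> 'b::euclidean_space \<Rightarrow> complex"
  assumes eq: "AE z in lborel. f z = f' z"
    and [measurable]: "f' \<in> borel_measurable borel" "\<phi> \<in> borel_measurable borel"
  shows "AE x in lborel. (LINT y|lebesgue. f (x, y) * \<phi> y) = (LINT y|lborel. f' (x, y) * \<phi> y)"
proof -
  have "AE x in lborel. AE y in lborel. f (x, y) = f' (x, y)"
    by (rule lborel_pair.AE_pair) (unfold lborel_prod, rule eq)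
  then show ?thesis
  proof (rule eventually_mono)
    fix x assume "AE y in lborel. f (x, y) = f' (x, y)"
    then have "AE y in lborel. f (x, y) * \<phi> y = f' (x, y) * \<phi> y"
      by (rule eventually_mono) simp
    moreover have "(\<lambda>y. f' (x, y) * \<phi> y) \<in> borel_measurable borel"
      by measurable
    ultimately show "(LINT y|lebesgue. f (x, y) * \<phi> y) = (LINT y|lborel. f' (x, y) * \<phi> y)"
      by (intro lebesgue_integral_cong_AE)
  qed
qed

text \<open>The function is a limit of its cut-offs to balls, hence Lebesgue measurable. A Borel
  version is sought because Fubini is applied to the product of \<open>lborel\<close>
  measures.\<close>

lemma locally_integrable_borel_representative:
  fixes f :: "'a::euclidean_space \<Rightarrow> complex"
  assumes "locally_integrable f"
  obtains f' where "f' \<in> borel_measurable borel" "AE x in lborel. f x = f' x"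
    "\<And>l u. set_integrable lborel (box l u) f'"
proof -
  have int: "integrable lebesgue (\<lambda>x. indicator K x *\<^sub>R f x)" if "compact K" for K
    using assms that unfolding locally_integrable_def set_integrable_def by blast
  have f: "f \<in> borel_measurable lebesgue"
  proof (rule borel_measurable_LIMSEQ_metric)
    show "(\<lambda>x. indicator (cball 0 (real n)) x *\<^sub>R f x) \<in> borel_measurable lebesgue" for n
      by (rule borel_measurable_integrable[OF int[OF compact_cball]])
    show "(\<lambda>n. indicator (cball 0 (real n)) x *\<^sub>R f x) \<longlonglongrightarrow> f x" for x
    proof (rule tendsto_eventually)
      have "\<forall>\<^sub>F n in sequentially. norm x \<le> real n"
        by (meson eventually_sequentially nat_ceiling_le_eq)
      then show "\<forall>\<^sub>F n in sequentially. indicator (cball 0 (real n)) x *\<^sub>R f x = f x"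
        by eventually_elim simp
    qed
  qed
  obtain r where r: "r \<in> borel_measurable lborel" "AE x in lborel. Re (f x) = r x"
    using completion_ex_borel_measurable_real[OF measurable_compose[OF f borel_measurable_Re]] by auto
  obtain i where i: "i \<in> borel_measurable lborel" "AE x in lborel. Im (f x) = i x"
    using completion_ex_borel_measurable_real[OF measurable_compose[OF f borel_measurable_Im]] by auto
  define f' where "f' x = Complex (r x) (i x)" for x
  have f'[measurable]: "f' \<in> borel_measurable borel"
    using r(1) i(1) unfolding f'_def by (simp add: borel_measurable_complex_iff)
  have eq: "AE x in lborel. f x = f' x"
    using r(2) i(2) by eventually_elim (simp add: f'_def complex_eq_iff)
  have "set_integrable lborel (box l u) f'" for l u
  proof -
    have "integrable lebesgue (\<lambda>x. indicator (cbox l u) x *\<^sub>R f x)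
        \<longleftrightarrow> integrable lebesgue (\<lambda>x. indicator (cbox l u) x *\<^sub>R f' x)"
    proof (rule integrable_cong_AE)
      show "(\<lambda>x. indicator (cbox l u) x *\<^sub>R f x) \<in> borel_measurable lebesgue"
        by (rule borel_measurable_integrable[OF int[OF compact_cbox]])
      show "AE x in lebesgue. indicator (cbox l u) x *\<^sub>R f x = indicator (cbox l u) x *\<^sub>R f' x"
        using eq by (auto simp: AE_completion_iff elim: eventually_mono)
    qed (auto intro!: measurable_completion)
    then have "set_integrable lborel (cbox l u) f'"
      using int[OF compact_cbox] unfolding set_integrable_def
      by (subst (asm) integrable_completion) auto
    then show ?thesis
      by (rule set_integrable_subset) (auto simp: box_subset_cbox)
  qed
  with f' eq that show ?thesis by blast
qed

lemma set_integrable_box_translate: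
  fixes f :: "'a::euclidean_space \<Rightarrow> complex"
  assumes "\<And>l u. set_integrable lborel (box l u) f"
  shows "set_integrable lborel (box l u) (\<lambda>x. f (x + t))"
proof -
  have "indicator (box (l + t) (u + t)) (x + t) = (indicator (box l u) x :: real)" for x
    by (auto simp: indicator_def mem_box inner_add_left)
  with integrable_lborel_translate[OF assms[of "l + t" "u + t", unfolded set_integrable_def], of t]
  show ?thesis unfolding set_integrable_def by simp
qed

lemma set_integrable_mult_unimodular:
  fixes f g :: "'a::euclidean_space \<Rightarrow> complex"
  assumes f: "set_integrable lborel S f" and [measurable]: "g \<in> borel_measurable borel"
    and "\<And>x. norm (g x) = 1"
  shows "set_integrable lborel S (\<lambda>x. g x * f x)"
proof -
  have [measurable]: "(\<lambda>x. indicator S x *\<^sub>R f x) \<in> borel_measurable borel"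
    using borel_measurable_integrable[OF f[unfolded set_integrable_def]] by simp
  have "(\<lambda>x. g x * (indicator S x *\<^sub>R f x)) \<in> borel_measurable borel" by measurable
  then have "integrable lborel (\<lambda>x. g x * (indicator S x *\<^sub>R f x))"
    by (intro Bochner_Integration.integrable_bound[OF f[unfolded set_integrable_def]])
      (auto simp: norm_mult assms(3))
  then show ?thesis unfolding set_integrable_def by simp
qed

section \<open>The symplectic relations and the phase\<close>

lemma sum_UNIV_sum:
  fixes f :: "'a::finite + 'b::finite \<Rightarrow> 'c::comm_monoid_add"
  shows "(\<Sum>x\<in>UNIV. f x) = (\<Sum>x\<in>UNIV. f (Inl x)) + (\<Sum>x\<in>UNIV. f (Inr x))"
  using sum.Plus[of "UNIV :: 'a set" "UNIV :: 'b set" f] by simp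

lemma block_mat_mult:
  "block_mat A B C D ** block_mat A' B' C' D' =
    block_mat (A ** A' + B ** C') (A ** B' + B ** D') (C ** A' + D ** C') (C ** B' + D ** D')"
  by (simp add: vec_eq_iff block_mat_def matrix_matrix_mult_def sum_UNIV_sum split: sum.split)

lemma matrix_mult_minus:
  fixes A :: "'a::ring_1^'n^'m" and B :: "'a^'p^'n"
  shows "(- A) ** B = - (A ** B)" "A ** (- B) = - (A ** B)"
  by (simp_all add: vec_eq_iff matrix_matrix_mult_def sum_negf)

lemma transpose_block_mat:
  "transpose (block_mat A B C D) = block_mat (transpose A) (transpose C) (transpose B) (transpose D)"
  by (simp add: vec_eq_iff block_mat_def transpose_def split: sum.split)

lemma block_mat_eq_iff:
  "block_mat A B C D = block_mat A' B' C' D' \<longleftrightarrow> A = A' \<and> B = B' \<and> C = C' \<and> D = D'"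
  by (auto simp: vec_eq_iff block_mat_def split: sum.split) 

lemma blocks_block_mat [simp]:
  "upper_left (block_mat A B C D) = A" "upper_right (block_mat A B C D) = B"
  "lower_left (block_mat A B C D) = C" "lower_right (block_mat A B C D) = D"
  by (simp_all add: vec_eq_iff block_mat_def upper_left_def upper_right_def lower_left_def lower_right_def)

text \<open>These are the blocks of \<open>M^t J M = J\<close>, with the transposes moved across the
  inner product.\<close>

lemma Sp_block_identities:
  assumes "block_mat A B C D \<in> Sp"
  shows "(A *v p) \<bullet> (C *v q) = (C *v p) \<bullet> (A *v q)"
    and "(A *v p) \<bullet> (D *v q) = (C *v p) \<bullet> (B *v q) + p \<bullet> q"
    and "(B *v p) \<bullet> (D *v q) = (D *v p) \<bullet> (B *v q)"
proof -
  have "transpose A ** C - transpose C ** A = 0 \<and> transpose A ** D - transpose C ** B = mat 1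
      \<and> transpose B ** D - transpose D ** B = 0"
    using assms
    by (simp add: Sp_def J_mat_def transpose_block_mat block_mat_mult block_mat_eq_iff
        matrix_mult_minus)
  then have "transpose A ** C = transpose C ** A" "transpose A ** D = transpose C ** B + mat 1"
      "transpose B ** D = transpose D ** B"
    by (simp_all add: algebra_simps)
  moreover have "(M *v p) \<bullet> (N *v q) = p \<bullet> ((transpose M ** N) *v q)" for M N :: "real^'a^'a"
    by (simp only: matrix_vector_mul_assoc[symmetric] dot_lmul_matrix[symmetric] vector_transpose_matrix)
  ultimately show "(A *v p) \<bullet> (C *v q) = (C *v p) \<bullet> (A *v q)"
    and "(A *v p) \<bullet> (D *v q) = (C *v p) \<bullet> (B *v q) + p \<bullet> q"
    and "(B *v p) \<bullet> (D *v q) = (D *v p) \<bullet> (B *v q)"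
    by (simp_all add: matrix_vector_mult_add_rdistrib inner_add_right)
qed

lemma matrix_inv_det_nonzero:
  fixes B :: "real^'n^'n"
  assumes "det B \<noteq> 0"
  shows "B ** matrix_inv B = mat 1" "matrix_inv B ** B = mat 1"
proof -
  have "\<exists>B'. B ** B' = mat 1 \<and> B' ** B = mat 1"
    using assms unfolding invertible_det_nz[symmetric] invertible_def .
  from someI_ex[OF this] show "B ** matrix_inv B = mat 1" "matrix_inv B ** B = mat 1"
    unfolding matrix_inv_def by simp_all
qed

text \<open>For a matrix of \<open>Sp\<close> with \<open>det B \<noteq> 0\<close> this is the
  generating function of the linear map sending (y, eta) to (x, xi): its gradient in
  \<open>x\<close> is xi, in \<open>y\<close> it is -eta.\<close>

definition kernel_phase ::
    "real^'n^'n \<Rightarrow> real^'n^'n \<Rightarrow> real^'n^'n \<Rightarrow> real^'n::finite \<Rightarrow> real^'n \<Rightarrow> real" where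
  "kernel_phase A B D x y = 1/2 * (x \<bullet> ((D ** matrix_inv B) *v x))
     - (matrix_inv B *v x) \<bullet> y + 1/2 * (y \<bullet> ((matrix_inv B ** A) *v y))"

text \<open>This is the covariance of the kernel at the level of phases. Both sides expand into
  values of the symmetric form \<open>(B *v z) \<bullet> (D *v w)\<close> and inner products with
  \<open>p\<close> and \<open>y\<close>, which match.\<close>

lemma kernel_phase_shift:
  assumes Sp: "block_mat A B C D \<in> Sp" and B: "det B \<noteq> 0"
    and p': "p' = A *v p + B *v q" and q': "q' = C *v p + D *v q"
  shows "kernel_phase A B D (x - p') y + (q' \<bullet> x - 1/2 * (p' \<bullet> q'))
    = kernel_phase A B D x (y + p) + (q \<bullet> y + 1/2 * (p \<bullet> q))"
proof -
  define \<beta> where "\<beta> = matrix_inv B"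
  have inv: "B ** \<beta> = mat 1" "\<beta> ** B = mat 1"
    unfolding \<beta>_def by (rule matrix_inv_det_nonzero[OF B])+
  have B\<beta>: "B *v (\<beta> *v z) = z" "\<beta> *v (B *v z) = z" for z
    by (simp_all add: matrix_vector_mul_assoc inv)
  \<comment> \<open>As \<open>B\<close> is invertible, \<open>A *v p\<close>, \<open>A *v y\<close>
    and \<open>x\<close> can all be written as images under \<open>B\<close>, where the symplectic
    relations apply.\<close>
  define r s where "r = \<beta> *v (A *v p)" and "s = \<beta> *v (A *v y)"
  define \<xi> where "\<xi> = \<beta> *v x"
  have Ap: "A *v p = B *v r" and Ay: "A *v y = B *v s" and x: "x = B *v \<xi>"
    by (simp_all add: r_def s_def \<xi>_def B\<beta>)
  have phase: "kernel_phase A B D z w = 1/2 * (z \<bullet> (D *v (\<beta> *v z))) - (\<beta> *v z) \<bullet> w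
      + 1/2 * (w \<bullet> (\<beta> *v (A *v w)))" for z w
    by (simp add: kernel_phase_def \<beta>_def[symmetric] matrix_vector_mul_assoc)
  have xp: "x - p' = B *v (\<xi> - r - q)"
    by (simp add: x p' Ap matrix_vector_mult_diff_distrib)
  note Sp = Sp_block_identities[OF Sp]
  \<comment> \<open>This is the symmetry of \<open>B\<inverse> A\<close>.\<close>
  have ps: "p \<bullet> s = y \<bullet> r"
    using Sp(2)[of p s] Sp(2)[of y r] Sp(1)[of y p] Sp(3)[of r s]
    by (simp add: Ap Ay inner_commute)
  \<comment> \<open>The second symplectic relation eliminates \<open>C\<close>.\<close>
  have CB: "(C *v p) \<bullet> (B *v z) = (B *v r) \<bullet> (D *v z) - p \<bullet> z" for z
    using Sp(2)[of p z] by (simp add: Ap)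
  have DB: "(D *v z) \<bullet> (B *v w) = (B *v z) \<bullet> (D *v w)" for z w
    by (simp add: Sp(3))
  have sym: "(B *v z) \<bullet> (D *v w) = (B *v w) \<bullet> (D *v z)" for z w
    using DB[of z w] by (simp add: inner_commute)
  have "p' \<bullet> q' = (B *v r) \<bullet> (D *v r) - p \<bullet> r + 2 * ((B *v r) \<bullet> (D *v q)) - p \<bullet> q
      + (B *v q) \<bullet> (D *v q)"
    using CB[of r] CB[of q]
    by (simp add: p' q' Ap inner_add_left inner_add_right inner_commute[of _ "C *v p"])
  moreover have "q' \<bullet> x = (B *v r) \<bullet> (D *v \<xi>) - p \<bullet> \<xi> + (B *v q) \<bullet> (D *v \<xi>)"
    using CB[of \<xi>] DB[of q \<xi>] by (simp add: q' x inner_add_left)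
  moreover have "kernel_phase A B D (x - p') y = 1/2 * ((B *v \<xi>) \<bullet> (D *v \<xi>) + (B *v r) \<bullet> (D *v r)
      + (B *v q) \<bullet> (D *v q)) - (B *v r) \<bullet> (D *v \<xi>) - (B *v q) \<bullet> (D *v \<xi>) + (B *v r) \<bullet> (D *v q)
      - \<xi> \<bullet> y + y \<bullet> r + q \<bullet> y + 1/2 * (y \<bullet> s)"
    using sym[of \<xi> r] sym[of \<xi> q] sym[of q r]
    unfolding phase xp B\<beta> s_def[symmetric] matrix_vector_mult_diff_distrib
    by (simp add: inner_diff_left inner_diff_right inner_add_left inner_add_right inner_commute[of r y] field_simps)
  moreover have "kernel_phase A B D x (y + p) = 1/2 * ((B *v \<xi>) \<bullet> (D *v \<xi>)) - \<xi> \<bullet> y - p \<bullet> \<xi>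
      + 1/2 * (y \<bullet> s) + y \<bullet> r + 1/2 * (p \<bullet> r)"
    using ps unfolding phase x B\<beta> matrix_vector_right_distrib s_def[symmetric] r_def[symmetric]
    by (simp add: inner_add_left inner_add_right inner_commute[of \<xi> p] field_simps)
  ultimately show ?thesis by (simp add: field_simps)
qed

section \<open>Covariance of the kernel\<close>

lemma schrodinger_cis:
  "schrodinger lam (p, q, 0) \<phi> x = cis (lam * (1/2 * (p \<bullet> q) - q \<bullet> x)) * \<phi> (x - p)"
proof -
  have "0 - q \<bullet> x + 1/2 * (p \<bullet> q) = 1/2 * (p \<bullet> q) - q \<bullet> x" by simp
  then show ?thesis by (simp only: schrodinger_def split_conv cis_conv_exp)
qed

lemma schrodinger_bump:
  "schrodinger lam (p, q, 0) (bump l u k) x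
    = cis (lam * (1/2 * (p \<bullet> q) - q \<bullet> x)) * bump (l + p) (u + p) k x"
  by (simp only: schrodinger_cis bump_translate)

text \<open>A constant phase times a plane wave times a translated bump: the kernel formula thus
  also applies to the transformed bump, which is why the class contains plane waves.\<close>

lemma schrodinger_bump_test_gen: "schrodinger lam (p, q, 0) (bump l u k) \<in> test_gen"
proof -
  have "(\<lambda>x. cis (lam * (1/2 * (p \<bullet> q))) * (exp (\<i> * complex_of_real ((- lam *\<^sub>R q) \<bullet> x))
      * bump (l + p) (u + p) k x)) \<in> test_gen"
    by (intro test_gen.intros bump_test_gen)
  also have "(\<lambda>x. cis (lam * (1/2 * (p \<bullet> q))) * (exp (\<i> * complex_of_real ((- lam *\<^sub>R q) \<bullet> x))
      * bump (l + p) (u + p) k x)) = schrodinger lam (p, q, 0) (bump l u k)"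
    unfolding cis_conv_exp[symmetric]
    by (simp add: fun_eq_iff schrodinger_bump mult.assoc[symmetric] cis_mult right_diff_distrib)
  finally show ?thesis .
qed

lemma borel_measurable_kernel_phase [measurable]:
  "(\<lambda>z. kernel_phase A B D (fst z) (snd z)) \<in> borel_measurable borel"
  unfolding kernel_phase_def
  by (intro borel_measurable_continuous_onI continuous_intros
      linear_continuous_on_compose[OF _ matrix_vector_mul_linear])

lemma borel_measurable_cis_compose:
  assumes "f \<in> borel_measurable M" shows "(\<lambda>x. cis (f x)) \<in> borel_measurable M"
  using assms by (rule measurable_compose[OF _ borel_measurable_continuous_onI]) (intro continuous_intros)

text \<open>Both sides of the relation are applied to a bump. On the left the kernel is translated
  in \<open>x\<close> by \<open>p'\<close>; on the right a change of variables moves the translation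
  of the bump onto the kernel in \<open>y\<close>. Bumps determine the kernel almost
  everywhere.\<close>

lemma intertwining_kernel_covariant:
  fixes A B C D :: "real^'n^'n::finite"
  assumes inter: "\<And>h \<phi>. \<phi> \<in> L2_space \<Longrightarrow>
      L2_eq (schrodinger lam (heis_act (block_mat A B C D) h) (U \<phi>)) (U (schrodinger lam h \<phi>))"
    and ker: "\<And>\<phi>. \<phi> \<in> schwartz_space \<Longrightarrow> L2_eq (U \<phi>) (\<lambda>x. LINT y|lebesgue. a x y * \<phi> y)"
    and rep: "AE z in lborel. (case z of (x, y) \<Rightarrow> a x y) = a' z"
    and meas[measurable]: "a' \<in> borel_measurable borel"
    and int: "\<And>l u. set_integrable lborel (box l u) a'"
    and p': "p' = A *v p + B *v q" and q': "q' = C *v p + D *v q"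
  shows "AE z in lborel. cis (lam * (1/2 * (p' \<bullet> q') - q' \<bullet> fst z)) * a' (z + (- p', 0))
    = cis (lam * (- (q \<bullet> snd z) - 1/2 * (p \<bullet> q))) * a' (z + (0, p))"
proof (rule AE_eq_if_bump_integrals_eq)
  let ?e = "\<lambda>x. cis (lam * (1/2 * (p' \<bullet> q') - q' \<bullet> x))"
  let ?e' = "\<lambda>y. cis (lam * (- (q \<bullet> y) - 1/2 * (p \<bullet> q)))"
  have e_meas[measurable]: "(\<lambda>z. ?e (fst z)) \<in> borel_measurable (borel :: ((real^'n) \<times> (real^'n)) measure)"
      "(\<lambda>z. ?e' (snd z)) \<in> borel_measurable (borel :: ((real^'n) \<times> (real^'n)) measure)"
    by (intro borel_measurable_continuous_onI continuous_intros)+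
  show "set_integrable lborel (box l u) (\<lambda>z. ?e (fst z) * a' (z + (- p', 0)))" for l u
    by (intro set_integrable_mult_unimodular set_integrable_box_translate int e_meas) simp
  show "set_integrable lborel (box l u) (\<lambda>z. ?e' (snd z) * a' (z + (0, p)))" for l u
    by (intro set_integrable_mult_unimodular set_integrable_box_translate int e_meas) simp
  have [measurable]: "(\<lambda>z. a' (z + w)) \<in> borel_measurable borel" for w by measurable
  show "(\<lambda>z. ?e (fst z) * a' (z + (- p', 0))) \<in> borel_measurable borel"
    "(\<lambda>z. ?e' (snd z) * a' (z + (0, p))) \<in> borel_measurable borel"
    by measurable
  fix l u :: "real^'n" and k
  let ?\<phi> = "bump l u k" and ?\<psi> = "schrodinger lam (p, q, 0) (bump l u k)"
  have \<psi>0: "?\<psi> x = 0" if "x \<notin> cbox (l + p) (u + p)" for x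
    using that box_subset_cbox by (auto simp: schrodinger_bump intro!: bump_eq_0)
  have \<phi>0: "?\<phi> x = 0" if "x \<notin> cbox l u" for x
    using that box_subset_cbox by (auto intro!: bump_eq_0)
  have Uker: "AE x in lborel. U \<phi> x = (LINT y|lborel. a' (x, y) * \<phi> y)"
    if "\<phi> \<in> test_gen" "\<And>x. x \<notin> cbox c d \<Longrightarrow> \<phi> x = 0" for \<phi> c d
  proof -
    have "\<phi> \<in> schwartz_space" by (rule test_gen_schwartz[OF that(1) compact_cbox that(2)])
    from ker[OF this] have "AE x in lborel. U \<phi> x = (LINT y|lebesgue. a x y * \<phi> y)"
      by (simp add: L2_eq_def AE_completion_iff)
    moreover have "AE x in lborel. (LINT y|lebesgue. a x y * \<phi> y) = (LINT y|lborel. a' (x, y) * \<phi> y)"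
      using AE_kernel_integral_cong[OF rep meas test_gen_borel_measurable[OF that(1)]] by simp
    ultimately show ?thesis by eventually_elim simp
  qed
  have "?\<phi> \<in> L2_space" by (rule test_gen_L2[OF bump_test_gen compact_cbox \<phi>0])
  from inter[OF this, of "(p, q, 0)"]
  have "AE x in lborel. ?e x * U ?\<phi> (x - p') = U ?\<psi> x"
    by (simp only: L2_eq_def AE_completion_iff heis_act_def split_conv blocks_block_mat schrodinger_cis
        p'[symmetric] q'[symmetric])
  \<comment> \<open>Null sets are translation invariant, so the kernel formula may be used at
    \<open>x - p'\<close>.\<close>
  moreover have "AE x in lborel. U ?\<phi> (x - p') = (LINT y|lborel. a' (x - p', y) * ?\<phi> y)"
    using AE_lborel_translate'(2)[OF Uker[OF bump_test_gen \<phi>0]] .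
  moreover have "AE x in lborel. U ?\<psi> x = (LINT y|lborel. a' (x, y) * ?\<psi> y)"
    by (rule Uker[OF schrodinger_bump_test_gen \<psi>0])
  ultimately show "AE x in lborel. (LINT y|lborel. ?e (fst (x, y)) * a' ((x, y) + (- p', 0)) * ?\<phi> y)
      = (LINT y|lborel. ?e' (snd (x, y)) * a' ((x, y) + (0, p)) * ?\<phi> y)"
  proof eventually_elim
    case (elim x)
    have [measurable]: "?\<psi> \<in> borel_measurable borel"
      by (rule test_gen_borel_measurable[OF schrodinger_bump_test_gen])
    have "(LINT y|lborel. ?e (fst (x, y)) * a' ((x, y) + (- p', 0)) * ?\<phi> y)
        = ?e x * (LINT y|lborel. a' (x - p', y) * ?\<phi> y)"
      by (simp add: mult.assoc)
    also have "\<dots> = (LINT y|lborel. a' (x, y) * ?\<psi> y)"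
      using elim by simp
    \<comment> \<open>The substitution is valid even for a divergent integral: both sides then have
      the default value 0.\<close>
    also have "\<dots> = (LINT y|lborel. a' (x, y + p) * ?\<psi> (y + p))"
      by (rule integral_lborel_translate[symmetric]) measurable
    also have "\<dots> = (LINT y|lborel. ?e' (snd (x, y)) * a' ((x, y) + (0, p)) * ?\<phi> y)"
    proof -
      \<comment> \<open>Evaluating the phase at \<open>y + p\<close> subtracts
        \<open>p \<bullet> q\<close>, which turns \<open>1/2 * (p \<bullet> q)\<close> into its
        negative.\<close>
      have "?\<psi> (y + p) = ?e' y * ?\<phi> y" for y
        using bump_translate[of l u k "y + p" p]
        by (simp add: schrodinger_bump inner_add_right inner_commute algebra_simps)
      then show ?thesis by (simp add: ac_simps)
    qed
    finally show ?case .
  qed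
qed

section \<open>Constancy of the quotient of the kernel by the exponential\<close>

theorem proposition5p2:
  fixes lam :: real
    and g :: "real^('n::finite + 'n)^('n + 'n)"
    and A B C D :: "real^'n^'n"
    and U :: "(real^'n \<Rightarrow> complex) \<Rightarrow> (real^'n \<Rightarrow> complex)"
    and a :: "real^'n \<Rightarrow> real^'n \<Rightarrow> complex"
  assumes "lam > 0"
    and "g = block_mat A B C D"
    and "g \<in> Sp"
    and "det B \<noteq> 0"
    and "L2_unitary U"
    and "\<And>h \<phi>. \<phi> \<in> L2_space \<Longrightarrow>
           L2_eq (schrodinger lam (heis_act g h) (U \<phi>)) (U (schrodinger lam h \<phi>))"
    and "locally_integrable (\<lambda>(x, y). a x y)"
    and "\<And>\<phi>. \<phi> \<in> schwartz_space \<Longrightarrow>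
           L2_eq (U \<phi>) (\<lambda>x. LINT y|lebesgue. a x y * \<phi> y)"
  shows "\<exists>c::complex. AE (x, y) in lebesgue.
           a x y = c * exp (- \<i> * complex_of_real (lam *
             (1/2 * (x \<bullet> ((D ** matrix_inv B) *v x))
              - (matrix_inv B *v x) \<bullet> y
              + 1/2 * (y \<bullet> ((matrix_inv B ** A) *v y)))))"
proof -
  obtain a' where a'[measurable]: "a' \<in> borel_measurable borel"
    and rep: "AE z in lborel. (case z of (x, y) \<Rightarrow> a x y) = a' z"
    and int: "\<And>l u. set_integrable lborel (box l u) a'"
    using locally_integrable_borel_representative[OF assms(7)] by blast
  define Q where "Q z = kernel_phase A B D (fst z) (snd z)" for z
  \<comment> \<open>The exponential of the claim is \<open>cis (- (lam * Q z))\<close>, so this is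
    the kernel divided by it.\<close>
  define b where "b z = cis (lam * Q z) * a' z" for z
  have [measurable]: "(\<lambda>z. cis (lam * Q z)) \<in> borel_measurable borel"
    unfolding Q_def by (intro borel_measurable_cis_compose) measurable
  have b[measurable]: "b \<in> borel_measurable borel"
    unfolding b_def by measurable
  have "AE z in lborel. b (z + w) = b z" for w
  proof -
    obtain s t where w: "w = (s, t)" by fastforce
    \<comment> \<open>Chosen so that the covariance identity has \<open>p' = - s\<close> and
      \<open>p = - t\<close>; solving for \<open>q\<close> uses that \<open>B\<close> is
      invertible.\<close>
    define p q where "p = - t" and "q = matrix_inv B *v (- s - A *v p)"
    have "B ** matrix_inv B = mat 1"
      by (rule matrix_inv_det_nonzero[OF assms(4)])
    then have p': "- s = A *v p + B *v q"
      by (simp add: q_def matrix_vector_mul_assoc)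
    define q' where "q' = C *v p + D *v q"
    have "AE z in lborel. b (z + (s, 0)) = b (z + (0, p))"
      using intertwining_kernel_covariant[OF assms(6)[unfolded assms(2)] assms(8) rep a' int p' q'_def]
    proof (rule eventually_mono)
      fix z :: "(real^'n) \<times> (real^'n)"
      assume *: "cis (lam * (1/2 * (- s \<bullet> q') - q' \<bullet> fst z)) * a' (z + (- (- s), 0))
        = cis (lam * (- (q \<bullet> snd z) - 1/2 * (p \<bullet> q))) * a' (z + (0, p))"
      \<comment> \<open>\<open>R\<close> is the common value of the two sides of
        \<open>kernel_phase_shift\<close>. Once \<open>cis (lam * R)\<close> is factored out, the
        covariance identity remains.\<close>
      define R where "R = Q (z + (0, p)) + (q \<bullet> snd z + 1/2 * (p \<bullet> q))"
      have Q2: "Q (z + (0, p)) = R + (- (q \<bullet> snd z) - 1/2 * (p \<bullet> q))"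
        by (simp add: R_def)
      have Q1: "Q (z + (s, 0)) = R + (1/2 * (- s \<bullet> q') - q' \<bullet> fst z)"
        using kernel_phase_shift[OF assms(3)[unfolded assms(2)] assms(4) p' q'_def, of "fst z" "snd z"]
        by (simp add: R_def Q_def)
      have "b (z + (s, 0)) = cis (lam * R)
          * (cis (lam * (1/2 * (- s \<bullet> q') - q' \<bullet> fst z)) * a' (z + (s, 0)))"
        unfolding b_def Q1 by (simp only: distrib_left cis_mult[symmetric] mult.assoc)
      moreover have "b (z + (0, p)) = cis (lam * R)
          * (cis (lam * (- (q \<bullet> snd z) - 1/2 * (p \<bullet> q))) * a' (z + (0, p)))"
        unfolding b_def Q2 by (simp only: distrib_left cis_mult[symmetric] mult.assoc)
      ultimately show "b (z + (s, 0)) = b (z + (0, p))"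
        using * by simp
    qed
    \<comment> \<open>A further shift by \<open>t\<close> in \<open>y\<close> cancels
      \<open>p = - t\<close> on the right and completes \<open>(s, 0)\<close> to \<open>w\<close> on
      the left.\<close>
    from AE_lborel_translate'(1)[OF this, of "(0, t)"] show ?thesis
      by (simp add: w p_def add.assoc zero_prod_def[symmetric])
  qed
  then obtain c where "AE z in lborel. b z = c"
    using AE_const_if_translation_invariant[OF b] by blast
  with rep have "AE z in lborel. (case z of (x, y) \<Rightarrow> a x y) = c * cis (- (lam * Q z))"
  proof eventually_elim
    case (elim z)
    have "cis (- (lam * Q z)) * b z = a' z"
      by (simp add: b_def mult.assoc[symmetric] cis_mult)
    with elim show ?case by (simp add: mult.commute)
  qed
  then have "AE (x, y) in lebesgue. a x y = c * exp (- \<i> * complex_of_real (lam *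
             (1/2 * (x \<bullet> ((D ** matrix_inv B) *v x))
              - (matrix_inv B *v x) \<bullet> y
              + 1/2 * (y \<bullet> ((matrix_inv B ** A) *v y)))))"
    unfolding AE_completion_iff
    by (auto elim!: eventually_mono simp: Q_def kernel_phase_def cis_conv_exp)
  then show ?thesis ..
qed

end
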